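(* Let $p^*=\inf\{p\in(0,1): P_p(|C^{\to}(0)|=\infty)>0\}$ (which satisfies $\tfrac12<p^*<1$). For $i,j\in\mathbb{Z}^2$ consider the event $\{\mathrm{An}(i)\cap\mathrm{An}(j)=\emptyset\}$, which is the event that $X_i$ and $X_j$ are independent for a recursive max-linear process on the random DAG of open edges. Then: (a) for $p<p^*$, $\lim_{|i-j|\to\infty}P_p(\mathrm{An}(i)\cap\mathrm{An}(j)=\emptyset)=1$; (b) for $p>p^*$ there is a constant $0<C<1$ not depending on $|i-j|$ such that $0<P_p(\mathrm{An}(i)\cap\mathrm{An}(j)=\emptyset)\le C$ for all $i\neq j$.
   Context: Oriented square lattice: node set $\mathbb{Z}^2$, with a directed edge $u\to v$ if and only if $v-u\in\{(1,0),(0,1)\}$; $E(\mathbb{Z}^2)$ denotes this edge set; $|i-j|$ denotes the lattice distance $|i_1-j_1|+|i_2-j_2|$. Bernoulli bond percolation with parameter $p\in[0,1]$: each edge of $E(\mathbb{Z}^2)$ is independently declared open with probability $p$ and closed otherwise; $P_p$ is the resulting product measure on $\Omega=\{0,1\}^{E(\mathbb{Z}^2)}$. In a configuration, $\mathrm{An}(u)$ is the set consisting of $u$ and all nodes $v$ from which there is a directed path $v\to\cdots\to u$ consisting of open edges traversed in their orientation. $C^{\to}(0)$ is the set of nodes reachable from $0$ by a directed open path (open edges traversed in their orientation), and $|C^{\to}(0)|$ its cardinality. A recursive max-linear process on the random DAG formed by the open edges has $X_i,X_j$ independent if and only if $\mathrm{An}(i)\cap\mathrm{An}(j)=\emptys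et$.
   Formalization: Part (b) is stated for p* < p < 1: at p = 1 all edges are open, An(i) and An(j) always meet, and the claimed 0 < P_p fails; the recalled fact 1/2 < p* < 1 is neither assumed nor asserted. *)

theory Defs
  imports "HOL-Probability.Probability"
begin

type_synonym node = "int \<times> int"

text \<open>Edges of the oriented square lattice: (u, False) is the edge u -> u+(1,0),
  (u, True) is the edge u -> u+(0,1).  A configuration assigns True (open) or False (closed)
  to every edge.\<close>
type_synonym edge = "node \<times> bool"
type_synonym config = "edge \<Rightarrow> bool"

definition edge_head :: "edge \<Rightarrow> node" where
  "edge_head e = (if snd e then (fst (fst e), snd (fst e) + 1) else (fst (fst e) + 1, snd (fst e)))"

definition open_step :: "config \<Rightarrow> (node \<times> node) set" where
  "open_step \<omega> = {(fst e, edge_head e) | e. \<omega> e}"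

definition perc :: "real \<Rightarrow> config measure" where
  "perc p = (\<Pi>\<^sub>M e\<in>UNIV. measure_pmf (bernoulli_pmf p))"

definition An :: "config \<Rightarrow> node \<Rightarrow> node set" where
  "An \<omega> u = {v. (v, u) \<in> (open_step \<omega>)\<^sup>*}"

definition fwd_cluster :: "config \<Rightarrow> node set" where
  "fwd_cluster \<omega> = {v. ((0,0), v) \<in> (open_step \<omega>)\<^sup>*}"

definition p_crit :: real where
  "p_crit = Inf {p \<in> {0<..<1}. measure (perc p) {\<omega> \<in> space (perc p). infinite (fwd_cluster \<omega>)} > 0}"

definition lat_dist :: "node \<Rightarrow> node \<Rightarrow> int" where
  "lat_dist i j = \<bar>fst i - fst j\<bar> + \<bar>snd i - snd j\<bar>"

definition indep_prob :: "real \<Rightarrow> node \<Rightarrow> node \<Rightarrow> real" where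
  "indep_prob p i j = measure (perc p) {\<omega> \<in> space (perc p). An \<omega> i \<inter> An \<omega> j = {}}"

end

theory Submission
  imports Defs
begin

text \<open>Reflecting the lattice turns ancestor sets into forward clusters. Two forward clusters that meet
  include one that reaches a distance of half the separation, which is unlikely when there is no
  percolation.

  If percolation occurs with probability \<open>\<theta> > 0\<close>, the cluster of a node cannot stay in a strip: it
  would be extinguished with probability bounded below at every level. By symmetry it moves further
  to the right than any given distance, at some level, with probability at least \<open>\<theta>/4\<close>, and likewise to
  the left. Two paths from nodes of the same level that exchange sides have a common node, so the
  clusters of two such nodes meet with probability at least \<open>(\<theta>/4)\<^sup>2\<close>; for nodes of different levels one
  waits until the lower cluster reaches the level of the upper node.

  Finally the infimum defining the critical value is not taken over the empty set, by a planar
  duality argument for densities close to one.\<close>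

subsection \<open>The percolation measure\<close>

interpretation bern: product_prob_space "\<lambda>e::edge. measure_pmf (bernoulli_pmf p)" UNIV for p
  by (simp add: product_prob_space_def product_sigma_finite_def product_prob_space_axioms_def
      measure_pmf.prob_space_axioms prob_space_imp_sigma_finite)

interpretation perc: prob_space "perc p" for p
  unfolding perc_def by (rule bern.prob_space_axioms)

lemma space_perc [simp]: "space (perc p) = UNIV"
  by (simp add: perc_def space_PiM)

lemma measurable_edge [measurable]: "Measurable.pred (perc p) (\<lambda>\<omega>. \<omega> e)"
proof -
  have "(\<lambda>\<omega>. \<omega> e) \<in> perc p \<rightarrow>\<^sub>M measure_pmf (bernoulli_pmf p)"
    unfolding perc_def by (rule measurable_component_singleton) simp
  then show ?thesis
    by (simp add: measurable_def)
qed

lemma events_perc [measurable (raw), simp]: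
  "Measurable.pred (perc p) P \<Longrightarrow> {\<omega>. P \<omega>} \<in> sets (perc p)"
  by (simp add: pred_def)

lemma measurable_to_perc:
  assumes "\<And>e. Measurable.pred N (\<lambda>x. f x e)"
  shows "f \<in> N \<rightarrow>\<^sub>M perc p"
  unfolding perc_def
proof (rule measurable_PiM_single')
  fix e :: edge
  show "(\<lambda>x. f x e) \<in> N \<rightarrow>\<^sub>M measure_pmf (bernoulli_pmf p)"
    using assms[of e] by (simp add: measurable_def)
qed simp

lemma prob_closed:
  assumes "finite J" "0 \<le> p" "p \<le> 1"
  shows "perc.prob p {\<omega>. \<forall>e\<in>J. \<not> \<omega> e} = (1 - p) ^ card J"
proof -
  have "emeasure (perc p) {\<omega> \<in> space (perc p). \<forall>e\<in>J. \<omega> e \<in> {False}} = (\<Prod>e\<in>J. emeasure (measure_pmf (bernoulli_pmf p)) {False})"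
    unfolding perc_def by (rule bern.emeasure_PiM_Collect) (use assms in auto)
  also have "\<dots> = ennreal ((1 - p) ^ card J)"
    using assms by (simp add: emeasure_pmf_single ennreal_power)
  finally show ?thesis
    using assms by (simp add: measure_def)
qed

lemma prob_edge:
  assumes "0 \<le> p" "p \<le> 1"
  shows "perc.prob p {\<omega>. \<omega> e} = p"
proof -
  have "perc.prob p (space (perc p) - {\<omega>. \<not> \<omega> e}) = 1 - perc.prob p {\<omega>. \<not> \<omega> e}"
    by (rule perc.prob_compl) simp
  moreover have "perc.prob p {\<omega>. \<not> \<omega> e} = 1 - p"
    using prob_closed[of "{e}" p] assms by simp
  moreover have "space (perc p) - {\<omega>. \<not> \<omega> e} = {\<omega>. \<omega> e}"
    by auto
  ultimately show ?thesis by simp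
qed

section \<open>Independence of events carried by disjoint sets of edges\<close>

definition determined_by :: "(config \<Rightarrow> bool) \<Rightarrow> edge set \<Rightarrow> bool" where
  "determined_by P J \<longleftrightarrow> (\<forall>\<omega> \<omega>'. (\<forall>e\<in>J. \<omega> e = \<omega>' e) \<longrightarrow> P \<omega> \<longrightarrow> P \<omega>')"

lemma indep_coordinates:
  "perc.indep_vars p (\<lambda>_. measure_pmf (bernoulli_pmf p)) (\<lambda>e \<omega>. \<omega> e) UNIV"
proof -
  have rv: "(\<lambda>\<omega>. \<omega> e) \<in> perc p \<rightarrow>\<^sub>M measure_pmf (bernoulli_pmf p)" for e :: edge
    unfolding perc_def by (rule measurable_component_singleton) simp
  show ?thesis
    by (subst perc.indep_vars_iff_distr_eq_PiM[OF _ rv])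
      (simp_all add: perc_def bern.PiM_component distr_id2 restrict_UNIV)
qed

text \<open>Restrictions of the configuration to disjoint edge sets are independent random
  variables, and an event determined by \<open>J\<close> is a function of the restriction to
  \<open>J\<close>. Agreement on \<open>J\<close> is symmetric, so the one implication in
  \<open>determined_by\<close> yields an equivalence.\<close>

lemma prob_indep:
  assumes [measurable]: "Measurable.pred (perc p) P" "Measurable.pred (perc p) Q"
    and P: "determined_by P J" and Q: "determined_by Q K" and JK: "J \<inter> K = {}"
  shows "perc.prob p {\<omega>. P \<omega> \<and> Q \<omega>} = perc.prob p {\<omega>. P \<omega>} * perc.prob p {\<omega>. Q \<omega>}"
proof -
  let ?B = "\<lambda>_::edge. measure_pmf (bernoulli_pmf p)"
  \<comment> \<open>\<open>restrict\<close> leaves an arbitrary value outside \<open>L\<close>;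
    replacing it by False, that is closing all other edges, gives a configuration on which
    \<open>R\<close> can be evaluated.\<close>
  let ?X = "\<lambda>L R. {x \<in> space (PiM L ?B). R (\<lambda>e. e \<in> L \<and> x e)}"
  have ext: "(\<lambda>x e. e \<in> L \<and> x e) \<in> PiM L ?B \<rightarrow>\<^sub>M perc p" for L
  proof (rule measurable_to_perc)
    fix e show "Measurable.pred (PiM L ?B) (\<lambda>x. e \<in> L \<and> x e)"
    proof (cases "e \<in> L")
      case True
      then have "(\<lambda>x. x e) \<in> PiM L ?B \<rightarrow>\<^sub>M ?B e"
        by (rule measurable_component_singleton)
      with True show ?thesis by (simp add: measurable_def)
    qed simp
  qed
  have sets: "?X L R \<in> sets (PiM L ?B)" if "Measurable.pred (perc p) R" for L R
    using measurable_compose[OF ext that] by simp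
  have eq: "(\<lambda>\<omega>. restrict \<omega> L) -` ?X L R \<inter> space (perc p) = {\<omega>. R \<omega>}" if "determined_by R L" for L R
  proof -
    have "R (\<lambda>e. e \<in> L \<and> restrict \<omega> L e) = R \<omega>" for \<omega>
      using that unfolding determined_by_def by (smt (verit) restrict_apply')
    then show ?thesis by (auto simp: space_PiM)
  qed
  have "perc.indep_var p (PiM J ?B) (\<lambda>\<omega>. restrict \<omega> J) (PiM K ?B) (\<lambda>\<omega>. restrict \<omega> K)"
    using perc.indep_var_restrict[OF indep_coordinates JK] by simp
  from perc.indep_varD[OF this sets[OF assms(1)] sets[OF assms(2)]]
  have "perc.prob p ((\<lambda>x. (restrict x J, restrict x K)) -` (?X J P \<times> ?X K Q) \<inter> space (perc p))
    = perc.prob p {\<omega>. P \<omega>} * perc.prob p {\<omega>. Q \<omega>}"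
    by (simp only: eq[OF P] eq[OF Q])
  moreover have "(\<lambda>x. (restrict x J, restrict x K)) -` (?X J P \<times> ?X K Q) \<inter> space (perc p) = {\<omega>. P \<omega> \<and> Q \<omega>}"
    using eq[OF P] eq[OF Q] by blast
  ultimately show ?thesis by simp
qed

section \<open>Invariance under permutations of the edges\<close>

lemma distr_reindex:
  assumes "bij \<pi>"
  shows "distr (perc p) (perc p) (\<lambda>\<omega>. \<omega> \<circ> \<pi>) = perc p"
proof -
  have "distr (PiM UNIV (\<lambda>_. measure_pmf (bernoulli_pmf p))) (PiM UNIV (\<lambda>i. measure_pmf (bernoulli_pmf p))) (\<lambda>\<omega>. \<lambda>n\<in>UNIV. \<omega> (\<pi> n))
     = PiM UNIV (\<lambda>i. measure_pmf (bernoulli_pmf p))"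
    by (rule distr_PiM_reindex) (use assms in \<open>auto simp: bij_def measure_pmf.prob_space_axioms\<close>)
  then show ?thesis
    by (simp add: perc_def comp_def restrict_UNIV)
qed

lemma prob_reindex:
  assumes [measurable]: "Measurable.pred (perc p) P" and "bij \<pi>"
  shows "perc.prob p {\<omega>. P (\<omega> \<circ> \<pi>)} = perc.prob p {\<omega>. P \<omega>}"
proof -
  have m [measurable]: "(\<lambda>\<omega>. \<omega> \<circ> \<pi>) \<in> perc p \<rightarrow>\<^sub>M perc p"
    by (rule measurable_to_perc) (simp add: measurable_edge)
  have "perc.prob p {\<omega>. P \<omega>} = measure (distr (perc p) (perc p) (\<lambda>\<omega>. \<omega> \<circ> \<pi>)) {\<omega> \<in> space (perc p). P \<omega>}"
    by (simp add: distr_reindex[OF assms(2)])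
  also have "\<dots> = perc.prob p {\<omega>. P (\<omega> \<circ> \<pi>)}"
    by (subst measure_distr) (auto simp: vimage_def intro: events_perc[OF assms(1)])
  finally show ?thesis by simp
qed

section \<open>Coupling of different densities\<close>

lemma distr_PiM_pmf_map:
  fixes B :: "'a pmf"
  assumes "map_pmf f B = bernoulli_pmf p"
  shows "distr (PiM UNIV (\<lambda>_::edge. measure_pmf B)) (perc p) (\<lambda>x e. f (x e)) = perc p"
proof -
  interpret B: product_prob_space "\<lambda>e::edge. measure_pmf B" UNIV
    by (simp add: product_prob_space_def product_sigma_finite_def product_prob_space_axioms_def
        measure_pmf.prob_space_axioms prob_space_imp_sigma_finite)
  let ?M = "PiM UNIV (\<lambda>_::edge. measure_pmf B)"
  have rv: "(\<lambda>x. x e) \<in> ?M \<rightarrow>\<^sub>M measure_pmf B" for e :: edge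
    by (rule measurable_component_singleton) simp
  have f: "f \<in> measure_pmf B \<rightarrow>\<^sub>M measure_pmf (bernoulli_pmf p)" by simp
  have rv': "(\<lambda>x. f (x e)) \<in> ?M \<rightarrow>\<^sub>M measure_pmf (bernoulli_pmf p)" for e :: edge
    using measurable_compose[OF rv f] by simp
  have "B.indep_vars (\<lambda>_. measure_pmf B) (\<lambda>e x. x e) UNIV"
    by (subst B.indep_vars_iff_distr_eq_PiM[OF _ rv])
      (simp_all add: B.PiM_component distr_id2 restrict_UNIV)
  then have "B.indep_vars (\<lambda>_. measure_pmf (bernoulli_pmf p)) (\<lambda>e x. f (x e)) UNIV"
    by (rule B.indep_vars_compose2) simp
  then have "distr ?M (perc p) (\<lambda>x. \<lambda>e\<in>UNIV. f (x e))
      = PiM UNIV (\<lambda>e. distr ?M (measure_pmf (bernoulli_pmf p)) (\<lambda>x. f (x e)))"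
    by (subst (asm) B.indep_vars_iff_distr_eq_PiM[OF _ rv']) (simp_all add: perc_def restrict_UNIV)
  moreover have "distr ?M (measure_pmf (bernoulli_pmf p)) (\<lambda>x. f (x e)) = measure_pmf (bernoulli_pmf p)" for e :: edge
  proof -
    have "distr ?M (measure_pmf (bernoulli_pmf p)) (\<lambda>x. f (x e))
       = distr (distr ?M (measure_pmf B) (\<lambda>x. x e)) (measure_pmf (bernoulli_pmf p)) f"
      by (subst distr_distr[OF f rv]) (simp add: comp_def)
    also have "\<dots> = distr (measure_pmf B) (measure_pmf (bernoulli_pmf p)) f"
      by (simp add: B.PiM_component)
    also have "\<dots> = measure_pmf (map_pmf f B)"
      unfolding map_pmf_rep_eq by (rule distr_cong) simp_all
    finally show ?thesis using assms by simp
  qed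
  ultimately show ?thesis by (simp add: perc_def restrict_UNIV)
qed

text \<open>Monotone coupling: both configurations are read off one family of independent pairs of
  coins, and in every sample the sparser lies below the denser.\<close>

lemma prob_increasing_le:
  assumes P: "\<And>q. Measurable.pred (perc q) P"
    and inc: "\<And>\<omega> \<omega>'. \<omega> \<le> \<omega>' \<Longrightarrow> P \<omega> \<Longrightarrow> P \<omega>'"
    and "0 < p" "p \<le> q" "q \<le> 1"
  shows "perc.prob p {\<omega>. P \<omega>} \<le> perc.prob q {\<omega>. P \<omega>}"
proof -
  \<comment> \<open>The first coin opens an edge with probability \<open>q\<close>; the second
    retains it with probability \<open>p / q\<close>, so that both succeed with probability
    \<open>p\<close>.\<close>
  define B where "B = pair_pmf (bernoulli_pmf q) (bernoulli_pmf (p / q))"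
  let ?M = "PiM UNIV (\<lambda>_::edge. measure_pmf B)"
  have 1: "map_pmf fst B = bernoulli_pmf q"
    by (simp add: B_def map_fst_pair_pmf)
  have 2: "map_pmf (\<lambda>(a, b). a \<and> b) B = bernoulli_pmf p"
  proof (rule pmf_eqI)
    fix b
    have T: "pmf (map_pmf (\<lambda>(a, b). a \<and> b) B) True = p"
    proof -
      have "pmf (map_pmf (\<lambda>(a, b). a \<and> b) B) True = measure_pmf.prob B {(True, True)}"
        by (simp add: pmf_map vimage_def) (rule arg_cong[where f = "measure_pmf.prob B"], auto)
      also have "\<dots> = p"
        using assms(3-5) by (simp add: B_def pmf_pair measure_pmf_single)
      finally show ?thesis .
    qed
    show "pmf (map_pmf (\<lambda>(a, b). a \<and> b) B) b = pmf (bernoulli_pmf p) b"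
      using T assms(3-5) by (cases b) (simp_all add: pmf_False_conv_True)
  qed
  have m: "(\<lambda>x e. f (x e)) \<in> ?M \<rightarrow>\<^sub>M perc r" for f :: "bool \<times> bool \<Rightarrow> bool" and r
  proof (rule measurable_to_perc)
    fix e :: edge
    have rv: "(\<lambda>x. x e) \<in> ?M \<rightarrow>\<^sub>M measure_pmf B"
      by (rule measurable_component_singleton) simp
    show "Measurable.pred ?M (\<lambda>x. f (x e))"
      by (rule measurable_compose[OF rv]) simp
  qed
  have eq: "perc.prob r {\<omega>. P \<omega>} = measure ?M {x \<in> space ?M. P (\<lambda>e. f (x e))}"
    if "map_pmf f B = bernoulli_pmf r" for r f
    using P[of r]
    by (subst distr_PiM_pmf_map[OF that, symmetric], subst measure_distr[OF m])
      (auto intro!: arg_cong[where f = "measure ?M"] simp: pred_def)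
  interpret M: prob_space ?M
    by (rule prob_space_PiM) (rule measure_pmf.prob_space_axioms)
  show ?thesis
    unfolding eq[OF 1] eq[OF 2]
  proof (rule M.finite_measure_mono)
    show "{x \<in> space ?M. P (\<lambda>e. case x e of (a, b) \<Rightarrow> a \<and> b)} \<subseteq> {x \<in> space ?M. P (\<lambda>e. fst (x e))}"
      by (auto elim!: inc[rotated] simp: case_prod_unfold intro!: le_funI)
    show "{x \<in> space ?M. P (\<lambda>e. fst (x e))} \<in> sets ?M"
      using measurable_compose[OF m P] by simp
  qed
qed

subsection \<open>Forward clusters\<close>

definition slice :: "config \<Rightarrow> node \<Rightarrow> nat \<Rightarrow> node set" where
  "slice \<omega> u n = {v. (u, v) \<in> open_step \<omega> ^^ n}"

definition fwd :: "config \<Rightarrow> node \<Rightarrow> node set" where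
  "fwd \<omega> u = {v. (u, v) \<in> (open_step \<omega>)\<^sup>*}"

text \<open>A grading of the lattice: every edge raises it by one. Hence
  \<open>slice \<omega> u n\<close> is the part of the cluster of \<open>u\<close> on the level
  \<open>lev u + int n\<close>.\<close>

definition lev :: "node \<Rightarrow> int" where
  "lev v = fst v + snd v"

lemma fwd_eq: "fwd \<omega> u = (\<Union>n. slice \<omega> u n)"
  by (auto simp: fwd_def slice_def rtrancl_power)

lemma slice_0 [simp]: "slice \<omega> u 0 = {u}"
  by (auto simp: slice_def)

lemma slice_Suc:
  "v \<in> slice \<omega> u (Suc n) \<longleftrightarrow> (\<exists>e. fst e \<in> slice \<omega> u n \<and> \<omega> e \<and> v = edge_head e)"
  by (auto simp: slice_def open_step_def relcomp_unfold)

lemma slice_add: "w \<in> slice \<omega> u (m + n) \<longleftrightarrow> (\<exists>v\<in>slice \<omega> u m. w \<in> slice \<omega> v n)"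
  by (auto simp: slice_def relpow_add)

lemma fwd_trans: "v \<in> fwd \<omega> u \<Longrightarrow> fwd \<omega> v \<subseteq> fwd \<omega> u"
  by (auto simp: fwd_def)

lemma slice_subset_fwd: "slice \<omega> u n \<subseteq> fwd \<omega> u"
  by (auto simp: fwd_eq)

lemma measurable_slice [measurable]: "Measurable.pred (perc p) (\<lambda>\<omega>. v \<in> slice \<omega> u n)"
proof (induction n arbitrary: v)
  case (Suc n)
  note [measurable] = Suc
  show ?case
    unfolding slice_Suc by measurable
qed simp

lemma measurable_fwd [measurable]: "Measurable.pred (perc p) (\<lambda>\<omega>. v \<in> fwd \<omega> u)"
  unfolding fwd_eq by simp

lemma edge_head_cases:
  obtains "edge_head e = (fst (fst e) + 1, snd (fst e))" | "edge_head e = (fst (fst e), snd (fst e) + 1)"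
  by (cases "snd e") (auto simp: edge_head_def)

lemma slice_bounds:
  assumes "v \<in> slice \<omega> u n"
  shows "fst u \<le> fst v" "snd u \<le> snd v" "lev v = lev u + int n"
proof -
  have "fst u \<le> fst v \<and> snd u \<le> snd v \<and> lev v = lev u + int n"
    using assms
  proof (induction n arbitrary: v)
    case (Suc n)
    then obtain e where "fst e \<in> slice \<omega> u n" "v = edge_head e"
      by (auto simp: slice_Suc)
    with Suc.IH[of "fst e"] show ?case
      by (cases e rule: edge_head_cases) (auto simp: lev_def)
  qed simp
  then show "fst u \<le> fst v" "snd u \<le> snd v" "lev v = lev u + int n"
    by auto
qed

definition box :: "node \<Rightarrow> nat \<Rightarrow> node set" where
  "box u n = {fst u..fst u + int n} \<times> {snd u..snd u + int n}"

lemma finite_box [simp]: "finite (box u n)"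
  by (simp add: box_def)

lemma slice_subset_box: "slice \<omega> u n \<subseteq> box u n"
proof
  fix v assume "v \<in> slice \<omega> u n"
  from slice_bounds[OF this] show "v \<in> box u n"
    by (cases v) (auto simp: box_def lev_def)
qed

lemma box_mono: "m \<le> n \<Longrightarrow> box u m \<subseteq> box u n"
  by (auto simp: box_def)

lemma finite_slice [simp]: "finite (slice \<omega> u n)"
  by (rule finite_subset[OF slice_subset_box]) simp

lemma slice_empty_mono: "slice \<omega> u n = {} \<Longrightarrow> n \<le> m \<Longrightarrow> slice \<omega> u m = {}"
  using slice_add[of _ \<omega> u n "m - n"] by auto

text \<open>Slices are finite, lie on different levels, and stay empty once one is empty. Survival
  thus becomes a decreasing intersection of events, which gives its measurability and the limit in
  \<open>survival_tendsto\<close>.\<close>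

lemma infinite_fwd_iff: "infinite (fwd \<omega> u) \<longleftrightarrow> (\<forall>n. slice \<omega> u n \<noteq> {})"
proof
  assume inf: "infinite (fwd \<omega> u)"
  show "\<forall>n. slice \<omega> u n \<noteq> {}"
  proof (rule ccontr)
    assume "\<not> (\<forall>n. slice \<omega> u n \<noteq> {})"
    then obtain n where n: "slice \<omega> u n = {}" by auto
    have "fwd \<omega> u \<subseteq> (\<Union>m<n. slice \<omega> u m)"
      using slice_empty_mono[OF n] by (fastforce simp: fwd_eq not_less[symmetric])
    with inf show False
      by (meson finite_UN_I finite_lessThan finite_slice infinite_super)
  qed
next
  assume ne: "\<forall>n. slice \<omega> u n \<noteq> {}"
  define f where "f n = (SOME v. v \<in> slice \<omega> u n)" for n
  have f: "f n \<in> slice \<omega> u n" for n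
    using ne by (simp add: f_def some_in_eq)
  have "inj f"
    using slice_bounds(3)[OF f] by (intro injI) (metis add_left_cancel of_nat_eq_iff)
  moreover have "range f \<subseteq> fwd \<omega> u"
    using f by (auto simp: fwd_eq)
  ultimately show "infinite (fwd \<omega> u)"
    using infinite_super range_inj_infinite by blast
qed

lemma open_step_mono: "\<omega> \<le> \<omega>' \<Longrightarrow> open_step \<omega> \<subseteq> open_step \<omega>'"
  unfolding open_step_def le_fun_def le_bool_def by blast

text \<open>Growing a cluster for \<open>n\<close> steps examines only edges that leave nodes
  reached in fewer than \<open>n\<close> steps. The later statements on which edges determine a
  cluster event rest on this.\<close>

lemma slice_agree:
  assumes "\<And>e k. k < n \<Longrightarrow> fst e \<in> slice \<omega> u k \<Longrightarrow> \<omega> e = \<omega>' e" and "k \<le> n"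
  shows "slice \<omega>' u k = slice \<omega> u k"
  using assms(2)
proof (induction k)
  case (Suc k)
  then have "slice \<omega>' u k = slice \<omega> u k" "k < n" by auto
  with assms(1) show ?case
    unfolding set_eq_iff slice_Suc by blast
qed simp

subsection \<open>Symmetries\<close>

text \<open>An automorphism of the oriented lattice: the edge permutation \<open>\<pi>\<close>
  respects tails and heads. Point reflection reverses the edges and is treated apart in
  \<open>An_reflect\<close>.\<close>

definition lattice_symmetry :: "(node \<Rightarrow> node) \<Rightarrow> bool" where
  "lattice_symmetry f \<longleftrightarrow> bij f \<and>
    (\<exists>\<pi>. bij \<pi> \<and> (\<forall>e. fst (\<pi> e) = f (fst e) \<and> edge_head (\<pi> e) = f (edge_head e)))"

lemma lattice_symmetry_translation: "lattice_symmetry (\<lambda>v. (fst v + a, snd v + b))"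
  unfolding lattice_symmetry_def
proof (intro conjI exI[of _ "\<lambda>e. ((fst (fst e) + a, snd (fst e) + b), snd e)"] allI)
  show "bij (\<lambda>v. (fst v + a, snd v + b))"
    by (rule o_bij[of "\<lambda>v. (fst v - a, snd v - b)"]) (auto simp: fun_eq_iff)
  show "bij (\<lambda>e :: edge. ((fst (fst e) + a, snd (fst e) + b), snd e))"
    by (rule o_bij[of "\<lambda>e. ((fst (fst e) - a, snd (fst e) - b), snd e)"]) (auto simp: fun_eq_iff)
qed (auto simp: edge_head_def)

lemma lattice_symmetry_swap: "lattice_symmetry prod.swap"
  unfolding lattice_symmetry_def
proof (intro conjI exI[of _ "\<lambda>e. (prod.swap (fst e), \<not> snd e)"] allI)
  show "bij (\<lambda>e :: edge. (prod.swap (fst e), \<not> snd e))"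
    by (rule o_bij[of "\<lambda>e. (prod.swap (fst e), \<not> snd e)"]) (auto simp: fun_eq_iff)
qed (auto simp: edge_head_def)

lemma surj_ex: "surj f \<Longrightarrow> (\<exists>x. P (f x)) \<longleftrightarrow> (\<exists>y. P y)"
  by (metis surjD)

text \<open>Permuting the edges by \<open>\<pi>\<close> preserves the measure and carries the slices
  of \<open>u\<close> to those of \<open>f u\<close>.\<close>

lemma prob_slice_symmetry:
  assumes "lattice_symmetry f"
  shows "perc.prob p {\<omega>. \<exists>v\<in>slice \<omega> (f u) n. R v} = perc.prob p {\<omega>. \<exists>v\<in>slice \<omega> u n. R (f v)}"
proof -
  obtain \<pi> where f: "bij f" and \<pi>: "bij \<pi>"
    and e: "fst (\<pi> e) = f (fst e)" "edge_head (\<pi> e) = f (edge_head e)" for e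
    using assms unfolding lattice_symmetry_def by auto
  have *: "v \<in> slice (\<omega> \<circ> \<pi>) u n \<longleftrightarrow> f v \<in> slice \<omega> (f u) n" for v n \<omega>
  proof (induction n arbitrary: v)
    case 0
    then show ?case using f by (simp add: bij_def inj_eq)
  next
    case (Suc n)
    have "v \<in> slice (\<omega> \<circ> \<pi>) u (Suc n) \<longleftrightarrow> (\<exists>e. fst (\<pi> e) \<in> slice \<omega> (f u) n \<and> \<omega> (\<pi> e) \<and> f v = edge_head (\<pi> e))"
      unfolding slice_Suc using Suc f by (simp add: e bij_def inj_eq comp_def del: split_paired_Ex)
    also have "\<dots> \<longleftrightarrow> (\<exists>e. fst e \<in> slice \<omega> (f u) n \<and> \<omega> e \<and> f v = edge_head e)"
      by (rule surj_ex[OF bij_is_surj[OF \<pi>], of "\<lambda>e. fst e \<in> slice \<omega> (f u) n \<and> \<omega> e \<and> f v = edge_head e"])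
    finally show ?case unfolding slice_Suc .
  qed
  have "perc.prob p {\<omega>. \<exists>v\<in>slice (\<omega> \<circ> \<pi>) u n. R (f v)} = perc.prob p {\<omega>. \<exists>v\<in>slice \<omega> u n. R (f v)}"
    by (rule prob_reindex[OF _ \<pi>]) (simp add: Bex_def)
  moreover have "(\<exists>v\<in>slice (\<omega> \<circ> \<pi>) u n. R (f v)) \<longleftrightarrow> (\<exists>v\<in>slice \<omega> (f u) n. R v)" for \<omega>
    unfolding Bex_def * by (rule surj_ex[OF bij_is_surj[OF f], of "\<lambda>v. v \<in> slice \<omega> (f u) n \<and> R v"])
  ultimately show ?thesis by simp
qed

text \<open>The reflected image of an edge from \<open>a\<close> to \<open>b\<close> is traversed in
  the lattice from \<open>f b\<close> to \<open>f a\<close>, and \<open>\<pi>\<close> selects this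
  edge. Paths into \<open>u\<close> therefore become paths out of \<open>f u\<close>.\<close>

lemma An_reflect:
  fixes \<omega> :: config
  defines "\<pi> \<equiv> \<lambda>e :: edge. ((- fst (edge_head e), - snd (edge_head e)), snd e)"
    and "f \<equiv> \<lambda>v :: node. (- fst v, - snd v)"
  shows "v \<in> An (\<omega> \<circ> \<pi>) u \<longleftrightarrow> f v \<in> fwd \<omega> (f u)" and "bij \<pi>"
proof -
  have \<pi>\<pi>: "\<pi> (\<pi> e) = e" for e
    by (cases e; cases "snd e") (simp_all add: \<pi>_def edge_head_def)
  have ff: "f (f v) = v" for v
    by (simp add: f_def)
  from \<pi>\<pi> show "bij \<pi>"
    by (intro o_bij[of \<pi>]) (auto simp: fun_eq_iff)
  have \<pi>f: "fst (\<pi> e) = f (edge_head e)" "edge_head (\<pi> e) = f (fst e)" for e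
    by (auto simp: \<pi>_def f_def edge_head_def)
  have step: "(f b, f a) \<in> open_step \<omega>" if "(a, b) \<in> open_step (\<omega> \<circ> \<pi>)" for a b and \<omega> :: config
  proof -
    from that obtain e where "\<omega> (\<pi> e)" "a = fst e" "b = edge_head e"
      by (auto simp: open_step_def)
    then show ?thesis
      unfolding open_step_def mem_Collect_eq by (intro exI[of _ "\<pi> e"]) (simp add: \<pi>f)
  qed
  have path: "(f b, f a) \<in> (open_step \<omega>)\<^sup>*" if "(a, b) \<in> (open_step (\<omega> \<circ> \<pi>))\<^sup>*" for a b and \<omega> :: config
    using that by induction (auto intro: step converse_rtrancl_into_rtrancl)
  show "v \<in> An (\<omega> \<circ> \<pi>) u \<longleftrightarrow> f v \<in> fwd \<omega> (f u)"
  proof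
    assume "v \<in> An (\<omega> \<circ> \<pi>) u"
    then show "f v \<in> fwd \<omega> (f u)"
      using path[of v u \<omega>] by (simp add: An_def fwd_def)
  next
    \<comment> \<open>\<open>\<pi>\<close> and \<open>f\<close> are involutions, so the converse is
      the same transport applied to \<open>\<omega> \<circ> \<pi>\<close>.\<close>
    have "\<omega> \<circ> \<pi> \<circ> \<pi> = \<omega>" by (simp add: fun_eq_iff \<pi>\<pi>)
    moreover assume "f v \<in> fwd \<omega> (f u)"
    ultimately show "v \<in> An (\<omega> \<circ> \<pi>) u"
      using path[of "f u" "f v" "\<omega> \<circ> \<pi>"] by (simp add: An_def fwd_def ff)
  qed
qed

lemma indep_prob_eq:
  "indep_prob p i j = 1 - perc.prob p {\<omega>. fwd \<omega> (- fst i, - snd i) \<inter> fwd \<omega> (- fst j, - snd j) \<noteq> {}}"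
proof -
  let ?\<pi> = "\<lambda>e :: edge. ((- fst (edge_head e), - snd (edge_head e)), snd e)"
  let ?f = "\<lambda>v :: node. (- fst v, - snd v)"
  note refl = An_reflect
  \<comment> \<open>The reflection is undone on the configuration, so that measurability of ancestor
    sets follows from that of forward clusters.\<close>
  have An_eq: "v \<in> An \<omega> u \<longleftrightarrow> ?f v \<in> fwd (\<omega> \<circ> inv ?\<pi>) (?f u)" for \<omega> v u
  proof -
    have "\<omega> = (\<omega> \<circ> inv ?\<pi>) \<circ> ?\<pi>"
      using refl(2) by (auto simp: fun_eq_iff bij_def)
    then show ?thesis using refl(1)[of v "\<omega> \<circ> inv ?\<pi>" u] by simp
  qed
  have fwd_m: "Measurable.pred (perc p) (\<lambda>\<omega>. v \<in> fwd (\<omega> \<circ> inv ?\<pi>) w)" for v w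
    by (rule measurable_compose[OF measurable_to_perc measurable_fwd]) simp
  have An_m [measurable]: "Measurable.pred (perc p) (\<lambda>\<omega>. v \<in> An \<omega> u)" for v u
    unfolding An_eq by (rule fwd_m)
  have "perc.prob p {\<omega>. \<exists>v. v \<in> An (\<omega> \<circ> ?\<pi>) i \<and> v \<in> An (\<omega> \<circ> ?\<pi>) j}
      = perc.prob p {\<omega>. \<exists>v. v \<in> An \<omega> i \<and> v \<in> An \<omega> j}"
    by (rule prob_reindex[OF _ refl(2)]) measurable
  moreover have "(\<exists>v. v \<in> An (\<omega> \<circ> ?\<pi>) i \<and> v \<in> An (\<omega> \<circ> ?\<pi>) j) \<longleftrightarrow> fwd \<omega> (?f i) \<inter> fwd \<omega> (?f j) \<noteq> {}" for \<omega>
    unfolding refl(1) by (auto simp: set_eq_iff) (metis minus_minus)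
  moreover have "perc.prob p (space (perc p) - {\<omega>. \<exists>v. v \<in> An \<omega> i \<and> v \<in> An \<omega> j})
      = 1 - perc.prob p {\<omega>. \<exists>v. v \<in> An \<omega> i \<and> v \<in> An \<omega> j}"
    by (rule perc.prob_compl) measurable
  moreover have "space (perc p) - {\<omega>. \<exists>v. v \<in> An \<omega> i \<and> v \<in> An \<omega> j} = {\<omega> \<in> space (perc p). An \<omega> i \<inter> An \<omega> j = {}}"
    by auto
  ultimately show ?thesis
    by (simp add: indep_prob_def)
qed

lemma measurable_meet [measurable]: "Measurable.pred (perc p) (\<lambda>\<omega>. fwd \<omega> u \<inter> fwd \<omega> v \<noteq> {})"
proof -
  have "(\<lambda>\<omega>. fwd \<omega> u \<inter> fwd \<omega> v \<noteq> {}) = (\<lambda>\<omega>. \<exists>w. w \<in> fwd \<omega> u \<and> w \<in> fwd \<omega> v)"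
    by auto
  then show ?thesis by simp
qed

lemma measurable_slice_empty [measurable]: "Measurable.pred (perc p) (\<lambda>\<omega>. slice \<omega> u n = {})"
proof -
  have "Measurable.pred (perc p) (\<lambda>\<omega>. \<forall>w. w \<notin> slice \<omega> u n)"
    by measurable
  also have "(\<lambda>\<omega>. \<forall>w. w \<notin> slice \<omega> u n) = (\<lambda>\<omega>. slice \<omega> u n = {})"
    by (simp only: all_not_in_conv)
  finally show ?thesis .
qed

lemma measurable_infinite_fwd [measurable]: "Measurable.pred (perc p) (\<lambda>\<omega>. infinite (fwd \<omega> u))"
  unfolding infinite_fwd_iff by measurable

subsection \<open>Survival probabilities\<close>

definition survival :: "real \<Rightarrow> nat \<Rightarrow> real" where
  "survival p n = perc.prob p {\<omega>. slice \<omega> (0, 0) n \<noteq> {}}"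

definition theta :: "real \<Rightarrow> real" where
  "theta p = perc.prob p {\<omega>. infinite (fwd \<omega> (0, 0))}"

lemma prob_slice_nonempty: "perc.prob p {\<omega>. slice \<omega> u n \<noteq> {}} = survival p n"
  using prob_slice_symmetry[OF lattice_symmetry_translation[of "fst u" "snd u"], of p "(0, 0)" n "\<lambda>_. True"]
  by (simp add: survival_def ex_in_conv Bex_def del: split_paired_Ex)

lemma survival_tendsto: "(\<lambda>n. perc.prob p {\<omega>. slice \<omega> u n \<noteq> {}}) \<longlonglongrightarrow> perc.prob p {\<omega>. infinite (fwd \<omega> u)}"
proof -
  have "(\<lambda>n. perc.prob p {\<omega>. slice \<omega> u n \<noteq> {}}) \<longlonglongrightarrow> perc.prob p (\<Inter>n. {\<omega>. slice \<omega> u n \<noteq> {}})"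
  proof (rule perc.finite_Lim_measure_decseq)
    show "decseq (\<lambda>n. {\<omega>. slice \<omega> u n \<noteq> {}})"
      unfolding decseq_def using slice_empty_mono by (intro allI impI subsetI CollectI) (simp, metis)
  qed auto
  then show ?thesis
    by (simp add: infinite_fwd_iff Collect_all_eq)
qed

lemma survival_tendsto_theta: "survival p \<longlonglongrightarrow> theta p"
  using survival_tendsto[of p "(0, 0)"] by (simp add: survival_def[abs_def] theta_def)

lemma prob_infinite_fwd: "perc.prob p {\<omega>. infinite (fwd \<omega> u)} = theta p"
  using LIMSEQ_unique[OF survival_tendsto[of p u]] survival_tendsto_theta[of p]
  by (simp add: prob_slice_nonempty)

lemma theta_le_survival: "theta p \<le> survival p n"
  unfolding theta_def survival_def
  by (rule perc.finite_measure_mono) (auto simp: infinite_fwd_iff)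

lemma theta_mono:
  assumes "0 < p" "p \<le> q" "q \<le> 1"
  shows "theta p \<le> theta q"
  unfolding theta_def
proof (rule prob_increasing_le[where P = "\<lambda>\<omega>. infinite (fwd \<omega> (0, 0))", OF _ _ assms])
  fix \<omega> \<omega>' :: config assume le: "\<omega> \<le> \<omega>'" and inf: "infinite (fwd \<omega> (0, 0))"
  have "fwd \<omega> (0, 0) \<subseteq> fwd \<omega>' (0, 0)"
    unfolding fwd_def using rtrancl_mono[OF open_step_mono[OF le]] by blast
  with inf show "infinite (fwd \<omega>' (0, 0))"
    by (rule infinite_super[rotated])
qed simp

lemma p_crit_eq: "p_crit = Inf {p \<in> {0<..<1}. theta p > 0}"
  by (simp add: p_crit_def theta_def fwd_def fwd_cluster_def)

lemma theta_eq_0: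
  assumes "0 \<le> p" "p < 1" "p < p_crit"
  shows "theta p = 0"
proof (cases "p = 0")
  \<comment> \<open>The infimum defining \<open>p_crit\<close> ranges over an open interval, so
    \<open>p = 0\<close> is settled directly: an infinite cluster needs an open edge out of the
    origin.\<close>
  case True
  have "theta p \<le> perc.prob p {\<omega>. \<omega> ((0, 0), False)} + perc.prob p {\<omega>. \<omega> ((0, 0), True)}"
    unfolding theta_def
  proof (rule order_trans[OF perc.finite_measure_mono measure_Un_le])
    show "{\<omega>. infinite (fwd \<omega> (0, 0))} \<subseteq> {\<omega>. \<omega> ((0, 0), False)} \<union> {\<omega>. \<omega> ((0, 0), True)}"
    proof safe
      fix \<omega> :: config assume "infinite (fwd \<omega> (0, 0))" "\<not> \<omega> ((0, 0), True)"
      then obtain v where "v \<in> slice \<omega> (0, 0) (Suc 0)"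
        unfolding infinite_fwd_iff by (metis all_not_in_conv)
      then obtain b where "\<omega> ((0, 0), b)"
        unfolding slice_Suc by auto
      with \<open>\<not> \<omega> ((0, 0), True)\<close> show "\<omega> ((0, 0), False)"
        by (cases b) auto
    qed
  qed auto
  with True show ?thesis
    by (simp add: prob_edge theta_def measure_le_0_iff)
next
  case False
  have "\<not> theta p > 0"
  proof
    assume "theta p > 0"
    then have "p_crit \<le> p"
      unfolding p_crit_eq using assms False by (intro cInf_lower bdd_belowI[of _ 0]) auto
    with assms show False by simp
  qed
  then show ?thesis
    by (simp add: theta_def zero_less_measure_iff)
qed

text \<open>An infimum over a nonempty set is approached from within, so some density below
  \<open>p\<close> percolates; monotonicity carries this up to \<open>p\<close>.\<close>

lemma theta_pos:
  assumes "{p \<in> {0<..<1}. theta p > 0} \<noteq> {}" "p_crit < p" "p < 1"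
  shows "theta p > 0"
proof -
  obtain p' where "0 < p'" "theta p' > 0" "p' < p"
    using cInf_lessD[OF assms(1)] assms(2) unfolding p_crit_eq by auto
  with theta_mono[of p' p] assms(3) show ?thesis by auto
qed

subsection \<open>The subcritical phase\<close>

lemma subcritical:
  assumes "theta p = 0" "\<epsilon> > 0"
  shows "\<exists>N::int. \<forall>i j. lat_dist i j \<ge> N \<longrightarrow> \<bar>indep_prob p i j - 1\<bar> < \<epsilon>"
proof -
  from survival_tendsto_theta[of p] assms obtain n where n: "survival p n < \<epsilon> / 2"
    using LIMSEQ_D[of "survival p" 0 "\<epsilon> / 2"] by (auto simp: survival_def)
  show ?thesis
  \<comment> \<open>If the clusters meet after \<open>a\<close> and \<open>b\<close> steps, the
    triangle inequality gives \<open>lat_dist i j \<le> a + b\<close>, so a distance of at least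
    \<open>2 * int n\<close> forces one of them to survive for \<open>n\<close> steps.\<close>
  proof (intro exI[of _ "2 * int n"] allI impI)
    fix i j assume ij: "lat_dist i j \<ge> 2 * int n"
    let ?i = "(- fst i, - snd i)" and ?j = "(- fst j, - snd j)"
    have "perc.prob p {\<omega>. fwd \<omega> ?i \<inter> fwd \<omega> ?j \<noteq> {}}
        \<le> perc.prob p {\<omega>. slice \<omega> ?i n \<noteq> {}} + perc.prob p {\<omega>. slice \<omega> ?j n \<noteq> {}}"
    proof (rule order_trans[OF perc.finite_measure_mono measure_Un_le])
      show "{\<omega>. fwd \<omega> ?i \<inter> fwd \<omega> ?j \<noteq> {}} \<subseteq> {\<omega>. slice \<omega> ?i n \<noteq> {}} \<union> {\<omega>. slice \<omega> ?j n \<noteq> {}}"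
      proof safe
        fix \<omega> v assume "v \<in> fwd \<omega> ?i" "v \<in> fwd \<omega> ?j" and "slice \<omega> ?j n = {}"
        then obtain a b where a: "v \<in> slice \<omega> ?i a" and b: "v \<in> slice \<omega> ?j b"
          by (auto simp: fwd_eq)
        with \<open>slice \<omega> ?j n = {}\<close> have "b < n"
          using slice_empty_mono[of \<omega> ?j n b] by force
        with ij slice_bounds[OF a] slice_bounds[OF b] have "n \<le> a"
          by (auto simp: lat_dist_def lev_def)
        moreover assume "slice \<omega> ?i n = {}"
        ultimately show "v \<in> {}"
          using slice_empty_mono[of \<omega> ?i n a] a by auto
      qed
    qed auto
    with n show "\<bar>indep_prob p i j - 1\<bar> < \<epsilon>"
      by (simp add: indep_prob_eq prob_slice_nonempty)
  qed
qed

subsection \<open>Percolation at density close to one\<close>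

text \<open>The node \<open>(a, b)\<close> also stands for the face of the lattice whose lower left corner it is.
  Dual paths step freely downwards and to the right, but cross edges upwards or to the left only
  if these are closed. The set of faces reachable by dual paths is thus closed under the free steps,
  and its boundary is an oriented open path.\<close>

datatype dir = North | West | South | East

fun move :: "dir \<Rightarrow> node \<Rightarrow> node" where
  "move North f = (fst f, snd f + 1)"
| "move West f = (fst f - 1, snd f)"
| "move South f = (fst f, snd f - 1)"
| "move East f = (fst f + 1, snd f)"

fun crossed :: "dir \<Rightarrow> node \<Rightarrow> edge set" where
  "crossed North f = {(move North f, False)}"
| "crossed West f = {(f, True)}"
| "crossed South f = {}"
| "crossed East f = {}"

fun visits :: "node \<Rightarrow> dir list \<Rightarrow> node list" where
  "visits f [] = [f]"
| "visits f (d # w) = f # visits (move d f) w"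

fun crossings :: "node \<Rightarrow> dir list \<Rightarrow> edge set" where
  "crossings f [] = {}"
| "crossings f (d # w) = crossed d f \<union> crossings (move d f) w"

definition dual_step :: "config \<Rightarrow> (node \<times> node) set" where
  "dual_step \<omega> = {(f, move d f) | d f. \<forall>e\<in>crossed d f. \<not> \<omega> e}"

text \<open>The loop erasure for \<open>dual_path_exists\<close>: a path that returns to its start
  \<open>f\<close> is replaced by its part after the return.\<close>

lemma visits_suffix:
  assumes "f \<in> set (visits h w)" "distinct (visits h w)"
  shows "\<exists>w'. distinct (visits f w') \<and> fold move w' f = fold move w h \<and> crossings f w' \<subseteq> crossings h w"
  using assms
proof (induction w arbitrary: h)
  case Nil
  then show ?case by (intro exI[of _ "[]"]) simp
next
  case (Cons d w)
  show ?case
  proof (cases "f = h")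
    case True
    then show ?thesis using Cons.prems(2) by (intro exI[of _ "d # w"]) simp
  next
    case False
    with Cons.IH[of "move d h"] Cons.prems
    obtain w' where "distinct (visits f w')" "fold move w' f = fold move w (move d h)"
      "crossings f w' \<subseteq> crossings (move d h) w"
      by auto
    then show ?thesis by (intro exI[of _ w']) auto
  qed
qed

text \<open>Simple paths are wanted because their crossed edges are distinct, so that the length
  controls the probability that all of them are closed.\<close>

lemma dual_path_exists:
  assumes "(f, g) \<in> (dual_step \<omega>)\<^sup>*"
  shows "\<exists>w. distinct (visits f w) \<and> fold move w f = g \<and> (\<forall>e\<in>crossings f w. \<not> \<omega> e)"
  using assms
proof (induction rule: converse_rtrancl_induct)
  case base
  show ?case by (intro exI[of _ "[]"]) simp
next
  case (step f h)
  then obtain d w where d: "h = move d f" "\<forall>e\<in>crossed d f. \<not> \<omega> e"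
    and w: "distinct (visits h w)" "fold move w h = g" "\<forall>e\<in>crossings h w. \<not> \<omega> e"
    unfolding dual_step_def by blast
  show ?case
  proof (cases "f \<in> set (visits h w)")
    case True
    from visits_suffix[OF this w(1)] w(2,3) show ?thesis by (metis subsetD)
  next
    case False
    with d w show ?thesis by (intro exI[of _ "d # w"]) auto
  qed
qed

text \<open>The face displayed is the one from which \<open>e\<close> is crossed: a vertical edge is
  its left side, a horizontal one its top side. Thus a simple path crosses no edge twice.\<close>

lemma crossings_visited:
  "e \<in> crossings h w \<Longrightarrow> (if snd e then fst e else move South (fst e)) \<in> set (visits h w)"
proof (induction w arbitrary: h)
  case (Cons d w)
  then show ?case
    by (cases "e \<in> crossings (move d h) w"; cases d) auto
qed simp

lemma finite_crossings: "finite (crossings f w)"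
proof (induction w arbitrary: f)
  case (Cons d w)
  then show ?case by (cases d) auto
qed simp

text \<open>The upward and leftward steps of a simple dual path cross distinct edges.\<close>

lemma card_crossings:
  assumes "distinct (visits f w)" "fold move w f = g"
  shows "2 * int (card (crossings f w)) = int (length w) + (snd g - snd f) - (fst g - fst f)"
  using assms
proof (induction w arbitrary: f)
  case (Cons d w)
  have new: "e \<notin> crossings (move d f) w" if "e \<in> crossed d f" for e
    using that Cons.prems(1) crossings_visited[of e "move d f" w] by (cases d) auto
  have "card (crossings f (d # w)) = card (crossed d f) + card (crossings (move d f) w)"
    using new by (cases d) (auto simp: finite_crossings)
  moreover have "2 * int (card (crossings (move d f) w))
      = int (length w) + (snd g - snd (move d f)) - (fst g - fst (move d f))"
    using Cons by simp
  \<comment> \<open>A step north or west adds two to the right-hand side, one for the length and one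
    for the displacement; for a step south or east the two contributions cancel.\<close>
  ultimately show ?case by (cases d) auto
qed simp

lemma infinite_fwd_of_dual:
  assumes "((0, 0), (0, 1)) \<notin> (dual_step \<omega>)\<^sup>*"
  shows "infinite (fwd \<omega> (0, 1))"
proof -
  define D where "D = {f. ((0, 0), f) \<in> (dual_step \<omega>)\<^sup>*}"
  \<comment> \<open>\<open>move South v\<close> is the face to the lower right of \<open>v\<close>,
    and \<open>move West v\<close> the one to the upper left: the boundary of \<open>D\<close>
    passes through these nodes.\<close>
  define B where "B = {v. move South v \<in> D \<and> move West v \<notin> D}"
  have D: "move d f \<in> D" if "f \<in> D" "\<forall>e\<in>crossed d f. \<not> \<omega> e" for d f
  proof -
    have "(f, move d f) \<in> dual_step \<omega>"
      using that(2) unfolding dual_step_def by blast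
    then show ?thesis
      using that(1) rtrancl.rtrancl_into_rtrancl unfolding D_def mem_Collect_eq by metis
  qed
  have "(0, 0) \<in> D" "(0, 1) \<notin> D"
    using assms by (auto simp: D_def)
  \<comment> \<open>\<open>(- 1, 1)\<close> is outside \<open>D\<close>, since a free step to the
    east would lead from it to \<open>(0, 1)\<close>.\<close>
  with D[of "(- 1, 1)" East] have start: "(0, 1) \<in> B"
    by (auto simp: B_def)
  \<comment> \<open>The upper right face of \<open>v\<close> decides the direction. If it is in
    \<open>D\<close>, the boundary goes up between it and the upper left face, otherwise to the
    right between it and the lower right face. The edge followed is open because a dual path could
    cross it if closed, and the free steps keep the next node in \<open>B\<close>.\<close>
  have step: "\<exists>e. fst e = v \<and> \<omega> e \<and> edge_head e \<in> B" if "v \<in> B" for v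
  proof (cases "v \<in> D")
    case True
    with that D[of v West] have "\<omega> (v, True)" by (auto simp: B_def)
    moreover have "edge_head (v, True) \<in> B"
      using that True D[of "(fst v - 1, snd v + 1)" South] by (auto simp: B_def edge_head_def)
    ultimately show ?thesis by (intro exI[of _ "(v, True)"]) simp
  next
    case False
    with that D[of "move South v" North] have "\<omega> (v, False)" by (auto simp: B_def)
    moreover have "edge_head (v, False) \<in> B"
      using that False D[of "move South v" East] by (auto simp: B_def edge_head_def)
    ultimately show ?thesis by (intro exI[of _ "(v, False)"]) simp
  qed
  have "slice \<omega> (0, 1) n \<inter> B \<noteq> {}" for n
  proof (induction n)
    case (Suc n)
    then obtain v where "v \<in> slice \<omega> (0, 1) n" "v \<in> B" by auto
    moreover obtain e where "fst e = v" "\<omega> e" "edge_head e \<in> B"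
      using step[OF \<open>v \<in> B\<close>] by blast
    ultimately have "edge_head e \<in> slice \<omega> (0, 1) (Suc n)"
      unfolding slice_Suc by blast
    with \<open>edge_head e \<in> B\<close> show ?case by blast
  qed (simp add: start)
  then show ?thesis
    unfolding infinite_fwd_iff by blast
qed

section \<open>Counting of dual paths\<close>

lemma card_dir_lists: "card {w :: dir list. length w = l} = 4 ^ l"
proof -
  have UNIV: "UNIV = {North, West, South, East}"
    using dir.exhaust by blast
  have "finite (UNIV :: dir set)" "card (UNIV :: dir set) = 4"
    by (simp_all add: UNIV)
  with card_lists_length_eq[of "UNIV :: dir set" l] show ?thesis by simp
qed

lemma finite_dir_lists: "finite {w :: dir list. length w = l}"
  using card_dir_lists[of l] by (intro card_ge_0_finite) simp

text \<open>Peierls argument: if the cluster of \<open>(0, 1)\<close> is finite, some simple dual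
  path leads from \<open>(0, 0)\<close> to \<open>(0, 1)\<close> through closed edges. At most
  \<open>4 ^ l\<close> paths have length \<open>l\<close>, and at this density the union bound sums
  to at most \<open>1/4\<close>.\<close>

lemma theta_near_one: "theta (63/64) > 0"
proof -
  let ?p = "63/64 :: real"
  define W where "W l = {w. length w = l \<and> distinct (visits (0, 0) w) \<and> fold move w (0, 0) = (0, 1)}" for l
  define U where "U l = (\<Union>w\<in>W l. {\<omega>. \<forall>e\<in>crossings (0, 0) w. \<not> \<omega> e})" for l
  have fin: "finite (W l)" and card: "card (W l) \<le> 4 ^ l" for l
    using finite_subset[OF _ finite_dir_lists[of l]] card_mono[OF finite_dir_lists[of l], of "W l"]
    by (auto simp: W_def card_dir_lists)
  have m: "{\<omega>. \<forall>e\<in>crossings (0, 0) w. \<not> \<omega> e} \<in> perc.events ?p" for w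
    using finite_crossings by (intro events_perc) simp
  have U: "U l \<in> perc.events ?p" for l
    unfolding U_def using fin m by auto
  have bound: "perc.prob ?p (U l) \<le> 1/8 * (1/2) ^ l" for l
  proof -
    \<comment> \<open>The displacement is \<open>(0, 1)\<close>, so \<open>card_crossings\<close>
      gives \<open>(l + 1) / 2\<close> crossed edges, each closed with probability
      \<open>1/64\<close>, the square of \<open>1/8\<close>.\<close>
    have closed: "perc.prob ?p {\<omega>. \<forall>e\<in>crossings (0, 0) w. \<not> \<omega> e} = (1/8) ^ (l + 1)" if "w \<in> W l" for w
    proof -
      have "2 * int (card (crossings (0, 0) w)) = int l + 1"
        using card_crossings[of "(0, 0)" w "(0, 1)"] that by (simp add: W_def)
      then have "2 * card (crossings (0, 0) w) = l + 1" by linarith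
      then have "((1/8 :: real)^2) ^ card (crossings (0, 0) w) = (1/8) ^ (l + 1)"
        by (simp add: power_mult[symmetric])
      then show ?thesis
        by (simp add: prob_closed finite_crossings power2_eq_square)
    qed
    have "perc.prob ?p (U l) \<le> (\<Sum>w\<in>W l. perc.prob ?p {\<omega>. \<forall>e\<in>crossings (0, 0) w. \<not> \<omega> e})"
      unfolding U_def by (rule perc.finite_measure_subadditive_finite[OF fin]) (use m in auto)
    also have "\<dots> = (\<Sum>w\<in>W l. (1/8) ^ (l + 1))"
      by (rule sum.cong[OF refl closed])
    also have "\<dots> \<le> 4 ^ l * (1/8) ^ (l + 1)"
      using card[of l] by (simp add: mult_right_mono)
    also have "\<dots> = 1/8 * (1/2) ^ l"
      by (simp add: power_mult_distrib[symmetric])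
    finally show ?thesis .
  qed
  have sums: "(\<lambda>l. 1/8 * (1/2 :: real) ^ l) sums (1/4)"
    using sums_mult[OF geometric_sums[of "1/2 :: real"], of "1/8"] by simp
  have sum: "summable (\<lambda>l. perc.prob ?p (U l))"
    by (rule summable_comparison_test'[OF sums_summable[OF sums]]) (use bound in simp)
  have "perc.prob ?p (\<Union>l. U l) \<le> (\<Sum>l. perc.prob ?p (U l))"
    using U sum by (intro perc.finite_measure_subadditive_countably) auto
  also have "\<dots> \<le> 1/4"
    using suminf_le[OF bound sum sums_summable[OF sums]] sums_unique[OF sums] by simp
  finally have "perc.prob ?p (\<Union>l. U l) \<le> 1/4" .
  moreover have "perc.prob ?p (space (perc ?p) - (\<Union>l. U l)) = 1 - perc.prob ?p (\<Union>l. U l)"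
    using U by (intro perc.prob_compl) auto
  moreover have "perc.prob ?p (space (perc ?p) - (\<Union>l. U l)) \<le> perc.prob ?p {\<omega>. infinite (fwd \<omega> (0, 1))}"
  proof (rule perc.finite_measure_mono)
    show "space (perc ?p) - (\<Union>l. U l) \<subseteq> {\<omega>. infinite (fwd \<omega> (0, 1))}"
    proof
      fix \<omega> assume \<omega>: "\<omega> \<in> space (perc ?p) - (\<Union>l. U l)"
      have "((0, 0), (0, 1)) \<notin> (dual_step \<omega>)\<^sup>*"
      proof
        assume "((0, 0), (0, 1)) \<in> (dual_step \<omega>)\<^sup>*"
        from dual_path_exists[OF this] obtain w where "w \<in> W (length w)" "\<forall>e\<in>crossings (0, 0) w. \<not> \<omega> e"
          by (auto simp: W_def)
        with \<omega> show False by (auto simp: U_def)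
      qed
      then show "\<omega> \<in> {\<omega>. infinite (fwd \<omega> (0, 1))}"
        by (simp add: infinite_fwd_of_dual)
    qed
  qed simp
  ultimately show ?thesis
    by (simp add: prob_infinite_fwd)
qed

subsection \<open>The supercritical phase\<close>

lemma measurable_Bex_slice [measurable]: "Measurable.pred (perc p) (\<lambda>\<omega>. \<exists>v\<in>slice \<omega> u n. R v)"
  unfolding Bex_def by measurable

lemma determined_slice_upto:
  "determined_by (\<lambda>\<omega>. Q (slice \<omega> u n)) {e. lev (fst e) < lev u + int n}"
  unfolding determined_by_def
proof (intro allI impI)
  fix \<omega> \<omega>' :: config assume "\<forall>e\<in>{e. lev (fst e) < lev u + int n}. \<omega> e = \<omega>' e" "Q (slice \<omega> u n)"
  moreover have "slice \<omega>' u n = slice \<omega> u n"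
  proof (rule slice_agree[of n])
    fix e :: edge and k assume "k < n" "fst e \<in> slice \<omega> u k"
    with slice_bounds(3)[OF this(2)] have "e \<in> {e. lev (fst e) < lev u + int n}" by simp
    with calculation(1) show "\<omega> e = \<omega>' e" by blast
  qed simp
  ultimately show "Q (slice \<omega>' u n)" by simp
qed

text \<open>Were the cluster confined to a strip at every level with probability bounded below, then at
  each level it would die out with probability bounded below.\<close>

lemma slice_spreads_right:
  assumes p: "0 \<le> p" "p < 1" and th: "theta p > 0"
  shows "\<exists>n. perc.prob p {\<omega>. \<exists>v\<in>slice \<omega> (0, 0) n. fst v - snd v \<ge> D} \<ge> theta p / 4"
proof (rule ccontr)
  assume "\<not> ?thesis"
  then have right: "perc.prob p {\<omega>. \<exists>v\<in>slice \<omega> (0, 0) n. fst v - snd v \<ge> D} < theta p / 4" for n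
    by (auto simp: not_le)
  have left: "perc.prob p {\<omega>. \<exists>v\<in>slice \<omega> (0, 0) n. snd v - fst v \<ge> D} < theta p / 4" for n
    using prob_slice_symmetry[OF lattice_symmetry_swap, of p "(0, 0)" n "\<lambda>v. snd v - fst v \<ge> D"] right[of n]
    by simp
  define T where "T n = {v. lev v = int n \<and> \<bar>fst v - snd v\<bar> < D}" for n
  define E where "E n = {e :: edge. fst e \<in> T n}" for n
  \<comment> \<open>On a fixed level an edge is determined by its direction and the difference of
    the coordinates of its tail, so \<open>k\<close> bounds the size of \<open>E n\<close> uniformly
    in \<open>n\<close>.\<close>
  define k where "k = card ({-D..D} \<times> (UNIV :: bool set))"
  have E: "finite (E n) \<and> card (E n) \<le> k" for n
  proof -
    have inj: "inj_on (\<lambda>e. (fst (fst e) - snd (fst e), snd e)) (E n)"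
      by (auto simp: inj_on_def E_def T_def lev_def)
    have im: "(\<lambda>e. (fst (fst e) - snd (fst e), snd e)) ` E n \<subseteq> {-D..D} \<times> UNIV"
      by (auto simp: E_def T_def)
    show ?thesis
      using card_inj_on_le[OF inj im] finite_imageD[OF finite_subset[OF im] inj] by (simp add: k_def)
  qed
  \<comment> \<open>\<open>theta p / 2\<close> is what remains of \<open>theta p\<close> after
    removing the two excursions, each of probability below \<open>theta p / 4\<close>; the other
    factor is the probability that \<open>k\<close> edges are closed.\<close>
  define \<kappa> where "\<kappa> = theta p / 2 * (1 - p) ^ k"
  have "\<kappa> > 0" using p th by (simp add: \<kappa>_def)
  have drop: "survival p (Suc n) \<le> survival p n - \<kappa>" for n
  proof -
    let ?conf = "\<lambda>\<omega>. slice \<omega> (0, 0) n \<noteq> {} \<and> slice \<omega> (0, 0) n \<subseteq> T n"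
    let ?cl = "\<lambda>\<omega>. \<forall>e\<in>E n. \<not> \<omega> e"
    have conf_m [measurable]: "Measurable.pred (perc p) ?conf"
      unfolding subset_iff by measurable
    have cl_m [measurable]: "Measurable.pred (perc p) ?cl"
      using E by simp
    have "theta p \<le> perc.prob p ({\<omega>. ?conf \<omega>} \<union> ({\<omega>. \<exists>v\<in>slice \<omega> (0, 0) n. fst v - snd v \<ge> D}
         \<union> {\<omega>. \<exists>v\<in>slice \<omega> (0, 0) n. snd v - fst v \<ge> D}))"
    proof (rule order_trans[OF theta_le_survival[of p n]], unfold survival_def, rule perc.finite_measure_mono)
      show "{\<omega>. slice \<omega> (0, 0) n \<noteq> {}} \<subseteq> {\<omega>. ?conf \<omega>} \<union> ({\<omega>. \<exists>v\<in>slice \<omega> (0, 0) n. fst v - snd v \<ge> D}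
         \<union> {\<omega>. \<exists>v\<in>slice \<omega> (0, 0) n. snd v - fst v \<ge> D})"
      proof
        fix \<omega> assume "\<omega> \<in> {\<omega>. slice \<omega> (0, 0) n \<noteq> {}}"
        moreover have "v \<in> T n" if "v \<in> slice \<omega> (0, 0) n" "\<not> fst v - snd v \<ge> D" "\<not> snd v - fst v \<ge> D" for v
          using that slice_bounds(3)[OF that(1)] by (simp add: T_def lev_def)
        ultimately show "\<omega> \<in> {\<omega>. ?conf \<omega>} \<union> ({\<omega>. \<exists>v\<in>slice \<omega> (0, 0) n. fst v - snd v \<ge> D}
         \<union> {\<omega>. \<exists>v\<in>slice \<omega> (0, 0) n. snd v - fst v \<ge> D})"
          by blast
      qed
    qed (intro sets.Un events_perc; measurable)
    also have "\<dots> \<le> perc.prob p {\<omega>. ?conf \<omega>} + (perc.prob p {\<omega>. \<exists>v\<in>slice \<omega> (0, 0) n. fst v - snd v \<ge> D}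
         + perc.prob p {\<omega>. \<exists>v\<in>slice \<omega> (0, 0) n. snd v - fst v \<ge> D})"
      by (intro order_trans[OF measure_Un_le] add_left_mono measure_Un_le sets.Un events_perc; measurable)
    finally have half: "theta p / 2 \<le> perc.prob p {\<omega>. ?conf \<omega>}"
      using left[of n] right[of n] by simp
    have "\<kappa> \<le> theta p / 2 * (1 - p) ^ card (E n)"
      using E[of n] p th unfolding \<kappa>_def by (intro mult_left_mono power_decreasing) auto
    also have "\<dots> \<le> perc.prob p {\<omega>. ?conf \<omega>} * perc.prob p {\<omega>. ?cl \<omega>}"
      using E[of n] p half by (simp add: prob_closed mult_right_mono)
    also have "\<dots> = perc.prob p {\<omega>. ?conf \<omega> \<and> ?cl \<omega>}"
    \<comment> \<open>Confinement depends on edges starting below level \<open>n\<close>, while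
      extinction is forced by edges starting on level \<open>n\<close>.\<close>
    proof (rule prob_indep[symmetric, OF conf_m cl_m])
      show "determined_by ?conf {e. lev (fst e) < lev (0, 0) + int n}"
        by (rule determined_slice_upto)
      show "determined_by ?cl (E n)"
        by (simp add: determined_by_def)
    qed (auto simp: E_def T_def lev_def)
    also have "\<dots> \<le> perc.prob p ({\<omega>. slice \<omega> (0, 0) n \<noteq> {}} - {\<omega>. slice \<omega> (0, 0) (Suc n) \<noteq> {}})"
    proof (rule perc.finite_measure_mono)
      show "{\<omega>. ?conf \<omega> \<and> ?cl \<omega>} \<subseteq> {\<omega>. slice \<omega> (0, 0) n \<noteq> {}} - {\<omega>. slice \<omega> (0, 0) (Suc n) \<noteq> {}}"
      proof safe
        fix \<omega> a b
        assume "slice \<omega> (0, 0) n \<subseteq> T n" "?cl \<omega>" "(a, b) \<in> slice \<omega> (0, 0) (Suc n)"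
        then show "(a, b) \<in> {}"
          unfolding slice_Suc E_def by blast
      qed
    qed (intro sets.Diff events_perc; simp)
    also have "\<dots> = survival p n - survival p (Suc n)"
      unfolding survival_def by (rule perc.finite_measure_Diff) (auto simp: slice_empty_mono[where n = n and m = "Suc n"])
    finally show ?thesis by simp
  qed
  \<comment> \<open>A loss of at least \<open>\<kappa>\<close> at every level would make the
    survival probability negative.\<close>
  have bound: "survival p n \<le> 1 - real n * \<kappa>" for n
  proof (induction n)
    case 0
    then show ?case by (simp add: survival_def)
  next
    case (Suc n)
    with drop[of n] show ?case by (simp add: algebra_simps)
  qed
  obtain n where "1 < real n * \<kappa>"
    using ex_less_of_nat_mult[OF \<open>\<kappa> > 0\<close>, of 1] by auto
  with bound[of n] have "survival p n < 0" by simp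
  then show False by (simp add: survival_def)
qed

text \<open>Discrete intermediate values: on a common level the difference of the first coordinates
  changes by at most one per step, so it cannot change sign without vanishing. Two configurations
  are allowed because the explored cluster and the path that runs into it are realised in different
  ones.\<close>

lemma paths_cross:
  assumes "v \<in> slice \<omega> i n" "w \<in> slice \<omega>' j n" "lev i = lev j" "fst i \<le> fst j" "fst w \<le> fst v"
  shows "\<exists>m\<le>n. slice \<omega> i m \<inter> slice \<omega>' j m \<noteq> {}"
  using assms
proof (induction n arbitrary: v w)
  case 0
  then show ?case by (auto simp: lev_def prod_eq_iff)
next
  case (Suc n)
  obtain e e' where e: "fst e \<in> slice \<omega> i n" "v = edge_head e"
    and e': "fst e' \<in> slice \<omega>' j n" "w = edge_head e'"
    using Suc.prems(1,2) by (auto simp: slice_Suc)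
  show ?case
  proof (cases "fst (fst e') \<le> fst (fst e)")
    case True
    with Suc.IH[OF e(1) e'(1)] Suc.prems show ?thesis by (meson le_SucI)
  next
    case False
    \<comment> \<open>Before the last step the second path is strictly to the right, afterwards it
      is not, so the first coordinates now agree.\<close>
    with e(2) e'(2) Suc.prems(5) have "fst v = fst w"
      by (cases e rule: edge_head_cases; cases e' rule: edge_head_cases) auto
    moreover have "lev v = lev w"
      using slice_bounds(3)[OF Suc.prems(1)] slice_bounds(3)[OF Suc.prems(2)] Suc.prems(3) by simp
    ultimately have "v = w" by (simp add: lev_def prod_eq_iff)
    with Suc.prems show ?thesis by blast
  qed
qed

text \<open>Sum over the finitely many values \<open>s\<close> that \<open>X\<close> takes on
  \<open>A\<close>: each event \<open>X \<omega> = s\<close> is combined with an independent event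
  \<open>H s\<close> of probability at least \<open>c\<close>, and these disjoint combinations lie
  in \<open>E\<close>.\<close>

lemma prob_ge_by_conditioning:
  assumes X: "\<And>s. Measurable.pred (perc p) (\<lambda>\<omega>. X \<omega> = s)" and fin: "finite (X ` Collect A)"
    and A: "Measurable.pred (perc p) A" and H: "\<And>s. Measurable.pred (perc p) (H s)"
    and indep: "\<And>s. s \<in> X ` Collect A \<Longrightarrow>
      perc.prob p {\<omega>. X \<omega> = s \<and> H s \<omega>} = perc.prob p {\<omega>. X \<omega> = s} * perc.prob p {\<omega>. H s \<omega>}"
    and c: "0 \<le> c" "\<And>s. s \<in> X ` Collect A \<Longrightarrow> c \<le> perc.prob p {\<omega>. H s \<omega>}"
    and sub: "\<And>\<omega> s. s \<in> X ` Collect A \<Longrightarrow> X \<omega> = s \<Longrightarrow> H s \<omega> \<Longrightarrow> E \<omega>"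
    and E: "Measurable.pred (perc p) E"
  shows "c * perc.prob p {\<omega>. A \<omega>} \<le> perc.prob p {\<omega>. E \<omega>}"
proof -
  let ?S = "X ` Collect A"
  note [measurable] = X A H E
  have "perc.prob p {\<omega>. A \<omega>} \<le> perc.prob p (\<Union>s\<in>?S. {\<omega>. X \<omega> = s})"
    by (rule perc.finite_measure_mono) (blast, intro sets.finite_UN[OF fin] events_perc X)
  also have "\<dots> \<le> (\<Sum>s\<in>?S. perc.prob p {\<omega>. X \<omega> = s})"
    by (rule perc.finite_measure_subadditive_finite[OF fin]) (auto intro!: events_perc)
  finally have "c * perc.prob p {\<omega>. A \<omega>} \<le> c * (\<Sum>s\<in>?S. perc.prob p {\<omega>. X \<omega> = s})"
    using c(1) by (rule mult_left_mono)
  also have "\<dots> \<le> (\<Sum>s\<in>?S. perc.prob p {\<omega>. X \<omega> = s \<and> H s \<omega>})"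
    unfolding sum_distrib_left
    by (intro sum_mono, subst indep) (auto simp: mult.commute intro!: mult_right_mono c(2))
  also have "\<dots> = perc.prob p (\<Union>s\<in>?S. {\<omega>. X \<omega> = s \<and> H s \<omega>})"
    by (intro perc.finite_measure_finite_Union[symmetric] fin)
      (auto simp: disjoint_family_on_def intro!: events_perc)
  also have "\<dots> \<le> perc.prob p {\<omega>. E \<omega>}"
    by (rule perc.finite_measure_mono) (auto intro: sub events_perc)
  finally show ?thesis .
qed

section \<open>Exploration of a cluster, and hitting of the explored set\<close>

lemma measurable_eq_set:
  assumes [measurable]: "\<And>v. Measurable.pred (perc p) (\<lambda>\<omega>. v \<in> X \<omega>)"
  shows "Measurable.pred (perc p) (\<lambda>\<omega>. X \<omega> = (s :: node set))"
  unfolding set_eq_iff by measurable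

definition hits :: "config \<Rightarrow> node \<Rightarrow> nat \<Rightarrow> node set \<Rightarrow> bool" where
  "hits \<omega> u n S \<longleftrightarrow> (\<exists>m\<le>n. slice \<omega> u m \<inter> S \<noteq> {})"

lemma measurable_hits [measurable]: "Measurable.pred (perc p) (\<lambda>\<omega>. hits \<omega> u n S)"
proof -
  have "hits \<omega> u n S \<longleftrightarrow> (\<exists>m\<in>{..n}. \<exists>v. v \<in> slice \<omega> u m \<and> v \<in> S)" for \<omega>
    unfolding hits_def by blast
  then show ?thesis by (simp only:) measurable
qed

text \<open>A path run until its first visit to \<open>S\<close> uses no edge that starts in \<open>S\<close>.\<close>

lemma determined_hits: "determined_by (\<lambda>\<omega>. hits \<omega> u n S) {e. fst e \<notin> S}"
  unfolding determined_by_def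
proof (intro allI impI)
  fix \<omega> \<omega>' :: config
  assume eq: "\<forall>e\<in>{e. fst e \<notin> S}. \<omega> e = \<omega>' e" and "hits \<omega> u n S"
  then obtain l where l: "l \<le> n" "slice \<omega> u l \<inter> S \<noteq> {}"
    unfolding hits_def by blast
  define m where "m = (LEAST m. slice \<omega> u m \<inter> S \<noteq> {})"
  have m: "m \<le> n" "slice \<omega> u m \<inter> S \<noteq> {}"
    unfolding m_def using l Least_le[of "\<lambda>m. slice \<omega> u m \<inter> S \<noteq> {}" l]
      LeastI[of "\<lambda>m. slice \<omega> u m \<inter> S \<noteq> {}" l] by simp_all
  have min: "slice \<omega> u k \<inter> S = {}" if "k < m" for k
    using not_less_Least[OF that[unfolded m_def]] by blast
  have "slice \<omega>' u m = slice \<omega> u m"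
  proof (rule slice_agree[of m])
    fix e :: edge and k assume "k < m" "fst e \<in> slice \<omega> u k"
    with min have "fst e \<notin> S" by blast
    with eq show "\<omega> e = \<omega>' e" by blast
  qed simp
  with m show "hits \<omega>' u n S" unfolding hits_def by auto
qed

definition cluster_upto :: "config \<Rightarrow> node \<Rightarrow> nat \<Rightarrow> node set" where
  "cluster_upto \<omega> u n = (\<Union>m\<in>{..n}. slice \<omega> u m)"

text \<open>The exploration examines only edges starting in explored nodes. They are disjoint from
  the edges in \<open>determined_hits\<close>, which makes hitting \<open>S\<close> independent of
  having explored exactly \<open>S\<close>.\<close>

lemma determined_cluster_upto: "determined_by (\<lambda>\<omega>. cluster_upto \<omega> u n = S) {e. fst e \<in> S}"
  unfolding determined_by_def
proof (intro allI impI)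
  fix \<omega> \<omega>' :: config
  assume eq: "\<forall>e\<in>{e. fst e \<in> S}. \<omega> e = \<omega>' e" and S: "cluster_upto \<omega> u n = S"
  have "slice \<omega>' u m = slice \<omega> u m" if "m \<le> n" for m
  proof (rule slice_agree[OF _ that])
    fix e :: edge and k assume "k < n" "fst e \<in> slice \<omega> u k"
    with S have "fst e \<in> S" unfolding cluster_upto_def by fastforce
    with eq show "\<omega> e = \<omega>' e" by blast
  qed
  with S show "cluster_upto \<omega>' u n = S" by (simp add: cluster_upto_def)
qed

lemma cluster_upto_subset_box: "cluster_upto \<omega> u n \<subseteq> box u n"
  unfolding cluster_upto_def using slice_subset_box box_mono by blast

lemma prob_slice_from:
  "perc.prob p {\<omega>. \<exists>v\<in>slice \<omega> i n. R (fst v - fst i) (snd v - snd i)}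
    = perc.prob p {\<omega>. \<exists>v\<in>slice \<omega> (0, 0) n. R (fst v) (snd v)}"
  using prob_slice_symmetry[OF lattice_symmetry_translation[of "fst i" "snd i"],
      of p "(0, 0)" n "\<lambda>v. R (fst v - fst i) (snd v - snd i)"]
  by simp

text \<open>Explore the cluster of the left node up to a level at which it has probably moved past the
  right node. A path of the right node moving past the left one must run into the explored set, and
  does so independently of it. This replaces the use of the FKG inequality.\<close>

lemma prob_meet_same_level:
  assumes p: "0 \<le> p" "p < 1" and th: "theta p > 0" and lev: "lev i = lev j"
  shows "(theta p / 4)\<^sup>2 \<le> perc.prob p {\<omega>. fwd \<omega> i \<inter> fwd \<omega> j \<noteq> {}}"
  using lev
proof (induction "fst i" "fst j" arbitrary: i j rule: linorder_wlog)
  case (le i j)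
  \<comment> \<open>A drift of \<open>D\<close> puts \<open>fst v\<close> at or beyond
    \<open>fst j + n / 2\<close> and \<open>fst w\<close> at or below \<open>fst i + n / 2\<close>,
    so the two paths have exchanged sides.\<close>
  define D where "D = 2 * (fst j - fst i)"
  obtain n where n: "perc.prob p {\<omega>. \<exists>v\<in>slice \<omega> (0, 0) n. fst v - snd v \<ge> D} \<ge> theta p / 4"
    using slice_spreads_right[OF p th] by blast
  define A where "A \<omega> \<longleftrightarrow> (\<exists>v\<in>slice \<omega> i n. (fst v - fst i) - (snd v - snd i) \<ge> D)" for \<omega>
  define B where "B \<omega> \<longleftrightarrow> (\<exists>v\<in>slice \<omega> j n. (snd v - snd j) - (fst v - fst j) \<ge> D)" for \<omega>
  have A_m: "Measurable.pred (perc p) A" and B_m: "Measurable.pred (perc p) B"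
    unfolding A_def B_def Bex_def by measurable
  have A: "perc.prob p {\<omega>. A \<omega>} \<ge> theta p / 4"
    unfolding A_def using n prob_slice_from[of p i n "\<lambda>a b. a - b \<ge> D"] by simp
  have B: "perc.prob p {\<omega>. B \<omega>} \<ge> theta p / 4"
    unfolding B_def using n prob_slice_from[of p j n "\<lambda>a b. b - a \<ge> D"]
      prob_slice_symmetry[OF lattice_symmetry_swap, of p "(0, 0)" n "\<lambda>v. snd v - fst v \<ge> D"] by simp
  have "theta p / 4 * perc.prob p {\<omega>. A \<omega>} \<le> perc.prob p {\<omega>. fwd \<omega> i \<inter> fwd \<omega> j \<noteq> {}}"
  proof (rule prob_ge_by_conditioning[where X = "\<lambda>\<omega>. cluster_upto \<omega> i n" and H = "\<lambda>S \<omega>. hits \<omega> j n S"])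
    show X: "Measurable.pred (perc p) (\<lambda>\<omega>. cluster_upto \<omega> i n = S)" for S
      by (rule measurable_eq_set) (simp add: cluster_upto_def)
    show "finite ((\<lambda>\<omega>. cluster_upto \<omega> i n) ` Collect A)"
      by (rule finite_subset[of _ "Pow (box i n)"]) (simp_all add: image_subsetI cluster_upto_subset_box)
    show "perc.prob p {\<omega>. cluster_upto \<omega> i n = S \<and> hits \<omega> j n S}
        = perc.prob p {\<omega>. cluster_upto \<omega> i n = S} * perc.prob p {\<omega>. hits \<omega> j n S}" for S
      by (rule prob_indep[OF X measurable_hits determined_cluster_upto determined_hits]) auto
    show "theta p / 4 \<le> perc.prob p {\<omega>. hits \<omega> j n S}" if S: "S \<in> (\<lambda>\<omega>. cluster_upto \<omega> i n) ` Collect A" for S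
    proof (rule order_trans[OF B perc.finite_measure_mono])
      obtain \<omega> v where \<omega>: "S = cluster_upto \<omega> i n" and v: "v \<in> slice \<omega> i n" "(fst v - fst i) - (snd v - snd i) \<ge> D"
        using S by (auto simp: A_def)
      show "{\<omega>. B \<omega>} \<subseteq> {\<omega>. hits \<omega> j n S}"
      proof safe
        fix \<omega>' assume "B \<omega>'"
        then obtain w where w: "w \<in> slice \<omega>' j n" "(snd w - snd j) - (fst w - fst j) \<ge> D"
          by (auto simp: B_def)
        have "fst w \<le> fst v"
          using slice_bounds(3)[OF v(1)] slice_bounds(3)[OF w(1)] v(2) w(2) le by (simp add: D_def lev_def)
        \<comment> \<open>The path to \<open>v\<close> lives in the configuration
          \<open>\<omega>\<close> that witnesses \<open>S\<close>, the path to \<open>w\<close> in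
          \<open>\<omega>'\<close>; their common node lies in \<open>S\<close>.\<close>
        from paths_cross[OF v(1) w(1) le(2) le(1) this] show "hits \<omega>' j n S"
          by (auto simp: hits_def \<omega> cluster_upto_def)
      qed
    qed simp
    show "fwd \<omega> i \<inter> fwd \<omega> j \<noteq> {}" if "cluster_upto \<omega> i n = S" "hits \<omega> j n S" for \<omega> S
      using that slice_subset_fwd unfolding hits_def cluster_upto_def by blast
  qed (use th A_m in auto)
  moreover have "(theta p / 4)\<^sup>2 \<le> theta p / 4 * perc.prob p {\<omega>. A \<omega>}"
    unfolding power2_eq_square using A th by (intro mult_left_mono) auto
  ultimately show ?case by linarith
next
  case (sym j i)
  then show ?case by (simp add: Int_commute)
qed

text \<open>The factor \<open>theta p\<close> accounts for the lower cluster reaching the level of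
  the upper node. The future from that level on uses other edges than the past, so the bound for a
  common level applies to one node reached there.\<close>

lemma prob_meet:
  assumes p: "0 \<le> p" "p < 1" and th: "theta p > 0"
  shows "(theta p / 4)\<^sup>2 * theta p \<le> perc.prob p {\<omega>. fwd \<omega> i \<inter> fwd \<omega> j \<noteq> {}}"
proof (induction "lev i" "lev j" arbitrary: i j rule: linorder_wlog)
  case (le i j)
  define m where "m = nat (lev j - lev i)"
  have m: "lev i + int m = lev j" using le by (simp add: m_def)
  \<comment> \<open>The choice is a function of the slice, hence a fixed node once the slice is
    given.\<close>
  define k where "k T = (SOME v :: node. v \<in> T)" for T
  have k_in: "k T \<in> T" if "T \<noteq> {}" for T
    unfolding k_def using that by (simp only: some_in_eq not_False_eq_True)
  define L where "L = {e :: edge. lev (fst e) < lev j}"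
  have "(theta p / 4)\<^sup>2 * perc.prob p {\<omega>. slice \<omega> i m \<noteq> {}} \<le> perc.prob p {\<omega>. fwd \<omega> i \<inter> fwd \<omega> j \<noteq> {}}"
  proof (rule prob_ge_by_conditioning[where X = "\<lambda>\<omega>. slice \<omega> i m" and H = "\<lambda>T \<omega>. fwd \<omega> (k T) \<inter> fwd \<omega> j \<noteq> {}"])
    show X: "Measurable.pred (perc p) (\<lambda>\<omega>. slice \<omega> i m = T)" for T
      by (rule measurable_eq_set) simp
    show "finite ((\<lambda>\<omega>. slice \<omega> i m) ` {\<omega>. slice \<omega> i m \<noteq> {}})"
      by (rule finite_subset[of _ "Pow (box i m)"]) (simp_all add: image_subsetI slice_subset_box)
    have k: "lev (k T) = lev j" if "T \<in> (\<lambda>\<omega>. slice \<omega> i m) ` {\<omega>. slice \<omega> i m \<noteq> {}}" for T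
    proof -
      from that obtain \<omega> where "T = slice \<omega> i m" "T \<noteq> {}" by blast
      then have "k T \<in> slice \<omega> i m" using k_in by simp
      from slice_bounds(3)[OF this] m show ?thesis by simp
    qed
    have det: "determined_by (\<lambda>\<omega>. fwd \<omega> a \<inter> fwd \<omega> j \<noteq> {}) (- L)" if "lev a = lev j" for a
      unfolding determined_by_def
    proof (intro allI impI)
      fix \<omega> \<omega>' :: config assume eq: "\<forall>e\<in>- L. \<omega> e = \<omega>' e" and ne: "fwd \<omega> a \<inter> fwd \<omega> j \<noteq> {}"
      have "fwd \<omega>' b = fwd \<omega> b" if "lev b = lev j" for b
      proof -
        have "slice \<omega>' b n = slice \<omega> b n" for n
        proof (rule slice_agree[of n])
          fix e :: edge and k assume "k < n" "fst e \<in> slice \<omega> b k"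
          with slice_bounds(3)[OF this(2)] that have "e \<in> - L" by (simp add: L_def)
          with eq show "\<omega> e = \<omega>' e" by blast
        qed simp
        then show ?thesis by (simp add: fwd_eq)
      qed
      with ne that show "fwd \<omega>' a \<inter> fwd \<omega>' j \<noteq> {}" by simp
    qed
    show "perc.prob p {\<omega>. slice \<omega> i m = T \<and> fwd \<omega> (k T) \<inter> fwd \<omega> j \<noteq> {}}
        = perc.prob p {\<omega>. slice \<omega> i m = T} * perc.prob p {\<omega>. fwd \<omega> (k T) \<inter> fwd \<omega> j \<noteq> {}}"
      if "T \<in> (\<lambda>\<omega>. slice \<omega> i m) ` {\<omega>. slice \<omega> i m \<noteq> {}}" for T
      by (rule prob_indep[OF X measurable_meet _ det[OF k[OF that]]])
        (use determined_slice_upto[of "\<lambda>A. A = T" i m] m in \<open>auto simp: L_def\<close>)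
    show "(theta p / 4)\<^sup>2 \<le> perc.prob p {\<omega>. fwd \<omega> (k T) \<inter> fwd \<omega> j \<noteq> {}}"
      if "T \<in> (\<lambda>\<omega>. slice \<omega> i m) ` {\<omega>. slice \<omega> i m \<noteq> {}}" for T
      by (rule prob_meet_same_level[OF p th k[OF that]])
    show "fwd \<omega> i \<inter> fwd \<omega> j \<noteq> {}"
      if T: "T \<in> (\<lambda>\<omega>. slice \<omega> i m) ` {\<omega>. slice \<omega> i m \<noteq> {}}" and "slice \<omega> i m = T" "fwd \<omega> (k T) \<inter> fwd \<omega> j \<noteq> {}" for \<omega> T
    proof -
      have "k T \<in> slice \<omega> i m"
        using T that(2) k_in by blast
      then have "fwd \<omega> (k T) \<subseteq> fwd \<omega> i"
        using slice_subset_fwd by (intro fwd_trans) blast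
      with that(3) show ?thesis by blast
    qed
  qed auto
  moreover have "(theta p / 4)\<^sup>2 * theta p \<le> (theta p / 4)\<^sup>2 * perc.prob p {\<omega>. slice \<omega> i m \<noteq> {}}"
    unfolding prob_slice_nonempty using theta_le_survival by (intro mult_left_mono) auto
  ultimately show ?case by linarith
next
  case (sym j i)
  then show ?case by (simp add: Int_commute)
qed

text \<open>With positive probability the four edges out of \<open>i\<close> and \<open>j\<close>
  are closed, and then both clusters are singletons.\<close>

lemma prob_disjoint_pos:
  assumes p: "0 \<le> p" "p < 1" and ij: "i \<noteq> j"
  shows "perc.prob p {\<omega>. fwd \<omega> i \<inter> fwd \<omega> j \<noteq> {}} < 1"
proof -
  let ?J = "{(i, False), (i, True), (j, False), (j, True)}"
  have fwd: "fwd \<omega> u = {u}" if "\<not> \<omega> (u, False)" "\<not> \<omega> (u, True)" for \<omega> u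
  proof -
    have closed: "\<not> \<omega> e" if "fst e = u" for e
    proof -
      have "e = (u, snd e)" using that by (simp add: prod_eq_iff)
      with \<open>\<not> \<omega> (u, False)\<close> \<open>\<not> \<omega> (u, True)\<close> show ?thesis
        by (metis (full_types))
    qed
    have "slice \<omega> u (Suc 0) = {}"
      unfolding set_eq_iff slice_Suc slice_0 using closed by blast
    then have "slice \<omega> u n \<subseteq> {u}" for n
      using slice_empty_mono[of \<omega> u "Suc 0" n] by (cases n) auto
    then show ?thesis
      unfolding fwd_eq using slice_0[of \<omega> u] by blast
  qed
  have "0 < (1 - p) ^ card ?J" using p by simp
  also have "\<dots> = perc.prob p {\<omega>. \<forall>e\<in>?J. \<not> \<omega> e}"
    using p by (intro prob_closed[symmetric]) auto
  also have "\<dots> \<le> perc.prob p (space (perc p) - {\<omega>. fwd \<omega> i \<inter> fwd \<omega> j \<noteq> {}})"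
  proof (rule perc.finite_measure_mono)
    have "fwd \<omega> i \<inter> fwd \<omega> j = {}" if "\<forall>e\<in>?J. \<not> \<omega> e" for \<omega>
      using that ij fwd[of \<omega> i] fwd[of \<omega> j] by simp
    then show "{\<omega>. \<forall>e\<in>?J. \<not> \<omega> e} \<subseteq> space (perc p) - {\<omega>. fwd \<omega> i \<inter> fwd \<omega> j \<noteq> {}}"
      by auto
    show "space (perc p) - {\<omega>. fwd \<omega> i \<inter> fwd \<omega> j \<noteq> {}} \<in> perc.events p"
      by (intro sets.compl_sets events_perc measurable_meet)
  qed
  also have "\<dots> = 1 - perc.prob p {\<omega>. fwd \<omega> i \<inter> fwd \<omega> j \<noteq> {}}"
    by (rule perc.prob_compl) simp
  finally show ?thesis by simp
qed

lemma supercritical: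
  assumes p: "0 \<le> p" "p < 1" and th: "theta p > 0"
  shows "\<exists>C. 0 < C \<and> C < 1 \<and> (\<forall>i j. i \<noteq> j \<longrightarrow> 0 < indep_prob p i j \<and> indep_prob p i j \<le> C)"
proof -
  \<comment> \<open>The bound of \<open>prob_meet\<close> does not depend on the nodes, so
    \<open>1 - ?d\<close> serves as \<open>C\<close>.\<close>
  let ?d = "(theta p / 4)\<^sup>2 * theta p"
  have "theta p \<le> 1" by (simp add: theta_def)
  then have "?d \<le> (1 / 4)\<^sup>2 * 1"
    using th by (intro mult_mono power_mono) auto
  then have "?d < 1" by (simp add: power2_eq_square)
  moreover have "0 < ?d" using th by simp
  moreover have "0 < indep_prob p i j \<and> indep_prob p i j \<le> 1 - ?d" if "i \<noteq> j" for i j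
  proof -
    have "(- fst i, - snd i) \<noteq> (- fst j, - snd j)"
      using that by (auto simp: prod_eq_iff)
    from prob_disjoint_pos[OF p this] prob_meet[OF p th, of "(- fst i, - snd i)" "(- fst j, - snd j)"]
    show ?thesis by (simp add: indep_prob_eq)
  qed
  ultimately show ?thesis by (intro exI[of _ "1 - ?d"]) auto
qed

section \<open>Bounds for the critical value, and the two phases\<close>

lemma supercritical_set_nonempty: "{p \<in> {0<..<1}. theta p > 0} \<noteq> {}"
  using theta_near_one by (intro ex_in_conv[THEN iffD1] exI[of _ "63/64"]) simp

text \<open>These bounds supply \<open>p < 1\<close> below the critical value and
  \<open>0 \<le> p\<close> above it.\<close>

lemma p_crit_bounds: "0 \<le> p_crit" "p_crit < 1"
proof -
  show "0 \<le> p_crit"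
    unfolding p_crit_eq by (rule cInf_greatest[OF supercritical_set_nonempty]) auto
  have "p_crit \<le> 63/64"
    unfolding p_crit_eq using theta_near_one by (intro cInf_lower bdd_belowI[of _ 0]) auto
  then show "p_crit < 1" by simp
qed

theorem theorem4p1:
  shows "(\<forall>p. 0 \<le> p \<and> p < p_crit \<longrightarrow>
            (\<forall>\<epsilon>>0. \<exists>N::int. \<forall>i j. lat_dist i j \<ge> N \<longrightarrow> \<bar>indep_prob p i j - 1\<bar> < \<epsilon>))
       \<and> (\<forall>p. p_crit < p \<and> p < 1 \<longrightarrow>
            (\<exists>C::real. 0 < C \<and> C < 1 \<and>
               (\<forall>i j. i \<noteq> j \<longrightarrow> 0 < indep_prob p i j \<and> indep_prob p i j \<le> C)))"
proof (intro conjI allI impI)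
  fix p \<epsilon> :: real assume "0 \<le> p \<and> p < p_crit" "0 < \<epsilon>"
  then show "\<exists>N::int. \<forall>i j. lat_dist i j \<ge> N \<longrightarrow> \<bar>indep_prob p i j - 1\<bar> < \<epsilon>"
    using p_crit_bounds by (intro subcritical theta_eq_0) auto
next
  fix p :: real assume "p_crit < p \<and> p < 1"
  then show "\<exists>C::real. 0 < C \<and> C < 1 \<and> (\<forall>i j. i \<noteq> j \<longrightarrow> 0 < indep_prob p i j \<and> indep_prob p i j \<le> C)"
    using p_crit_bounds theta_pos[OF supercritical_set_nonempty, of p] by (intro supercritical) auto
qed

end
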